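(* Let $G$ be an abelian group, let $(\mathcal{L}=\bigoplus_{g\in G}\mathcal{L}_g,[\cdot,\cdot],\alpha)$ be a finitely generated $G$-graded Hom-Lie algebra over $\mathbb{C}$, and let $V=\bigoplus_{g\in G}V_g$ be a $G$-graded Hom-$\mathcal{L}$-module. For every $D\in Der(\mathcal{L},V)$, we have $$D=\sum_{g\in G}D_g,$$ where $D_g\in Der(\mathcal{L},V)_g$ for every $g\in G$, and where, for any $u\in\mathcal{L}$, there are only finitely many $D_g(u)\neq 0$ in the equation $D(u)=\sum_{g\in G}D_g(u)$.
   Context: All vector spaces and algebras are over $\mathbb{C}$. A Hom-Lie algebra is a triple $(\mathcal{L},[\cdot,\cdot],\alpha)$ with $\mathcal{L}$ a vector space, $[\cdot,\cdot]$ a bilinear map $\mathcal{L}\times\mathcal{L}\to\mathcal{L}$ and $\alpha:\mathcal{L}\to\mathcal{L}$ linear such that $[x,y]=-[y,x]$ and $[[x,y],\alpha(z)]+[[y,z],\alpha(x)]+[[z,x],\alpha(y)]=0$ for all $x,y,z\in\mathcal{L}$. It is $G$-graded if $\mathcal{L}=\bigoplus_{g\in G}\mathcal{L}_g$ with $[\mathcal{L}_g,\mathcal{L}_h]\subseteq\mathcal{L}_{g+h}$ and $\alpha(\mathcal{L}_g)\subseteq\mathcal{L}_g$ for all $g,h\in G$. Finitely generated means generated as an algebra by finitely many elements. A Hom-$\mathcal{L}$-module (representation) is a vector space $V$ with $\beta\in End(V)$ and a linear map $\rho:\mathcal{L}\to End(V)$, written $x\cdot v=\rho(x)(v)$, such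 that $\rho([x,y])\circ\beta=\rho(\alpha(x))\circ\rho(y)-\rho(\alpha(y))\circ\rho(x)$ for all $x,y\in\mathcal{L}$. It is $G$-graded if $V=\bigoplus_{g\in G}V_g$ and $\mathcal{L}_g\cdot V_h\subseteq V_{g+h}$ for all $g,h\in G$. A derivation ($\alpha^0$-derivation) from $\mathcal{L}$ to $V$ is a linear map $D:\mathcal{L}\to V$ with $D\circ\alpha=\beta\circ D$ and $D([x,y])=x\cdot D(y)-y\cdot D(x)$ for all $x,y\in\mathcal{L}$. $Der(\mathcal{L},V)$ is the space of derivations. $D$ has degree $g$ if $D\neq0$ and $D(\mathcal{L}_h)\subseteq V_{g+h}$ for all $h\in G$; $Der(\mathcal{L},V)_g$ is the set of derivations of degree $g$ together with $0$.
   Formalization: The formal theorem additionally assumes β(V_g) ⊆ V_g for all g; without this the claim fails, e.g. for L=ℂ in degree 0 with zero bracket and action, α=id, and β swapping basis vectors e, f of V in distinct degrees, with D(1)=e+f. *)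

theory Defs
  imports Complex_Main
begin

text \<open>
  The vector spaces are whole types, with an explicit complex scalar multiplication;
  the grading group is a type of class \<^class>\<open>ab_group_add\<close>.
\<close>

locale hom_lie_algebra = vector_space scaleL
  for scaleL :: "complex \<Rightarrow> 'l::ab_group_add \<Rightarrow> 'l" +
  fixes bracket :: "'l \<Rightarrow> 'l \<Rightarrow> 'l"
    and \<alpha> :: "'l \<Rightarrow> 'l"
  assumes bracket_linear_left: "Vector_Spaces.linear scaleL scaleL (\<lambda>x. bracket x y)"
    and bracket_linear_right: "Vector_Spaces.linear scaleL scaleL (\<lambda>y. bracket x y)"
    and twist_linear: "Vector_Spaces.linear scaleL scaleL \<alpha>"
    and skew_symmetric: "bracket x y = - bracket y x"
    and hom_jacobi:
      "bracket (bracket x y) (\<alpha> z) + bracket (bracket y z) (\<alpha> x) + bracket (bracket z x) (\<alpha> y) = 0"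

locale hom_lie_module = hom_lie_algebra scaleL bracket \<alpha> + V: vector_space scaleV
  for scaleL :: "complex \<Rightarrow> 'l::ab_group_add \<Rightarrow> 'l"
    and bracket :: "'l \<Rightarrow> 'l \<Rightarrow> 'l"
    and \<alpha> :: "'l \<Rightarrow> 'l"
    and scaleV :: "complex \<Rightarrow> 'v::ab_group_add \<Rightarrow> 'v" +
  fixes \<beta> :: "'v \<Rightarrow> 'v"
    and \<rho> :: "'l \<Rightarrow> 'v \<Rightarrow> 'v"
  assumes module_twist_linear: "Vector_Spaces.linear scaleV scaleV \<beta>"
    and action_endo: "Vector_Spaces.linear scaleV scaleV (\<rho> x)"
    and action_linear: "Vector_Spaces.linear scaleL scaleV (\<lambda>x. \<rho> x v)"
    and action_bracket: "\<rho> (bracket x y) \<circ> \<beta> = (\<lambda>v. (\<rho> (\<alpha> x) \<circ> \<rho> y) v - (\<rho> (\<alpha> y) \<circ> \<rho> x) v)"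

text \<open>
  Internal direct sum: each vector is uniquely a finitely supported sum of homogeneous components.
\<close>

definition direct_sum_decomposition ::
    "(complex \<Rightarrow> 'v::ab_group_add \<Rightarrow> 'v) \<Rightarrow> ('g \<Rightarrow> 'v set) \<Rightarrow> bool" where
  "direct_sum_decomposition scale X \<longleftrightarrow>
     (\<forall>g. module.subspace scale (X g)) \<and>
     (\<forall>v. \<exists>!c. (\<forall>g. c g \<in> X g) \<and> finite {g. c g \<noteq> 0} \<and> v = (\<Sum>g | c g \<noteq> 0. c g))"

definition preserves_grading :: "('v \<Rightarrow> 'v) \<Rightarrow> ('g \<Rightarrow> 'v set) \<Rightarrow> bool" where
  "preserves_grading f X \<longleftrightarrow> (\<forall>g. f ` X g \<subseteq> X g)"

definition graded_hom_lie_algebra ::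
    "(complex \<Rightarrow> 'l::ab_group_add \<Rightarrow> 'l) \<Rightarrow> ('l \<Rightarrow> 'l \<Rightarrow> 'l) \<Rightarrow> ('l \<Rightarrow> 'l) \<Rightarrow>
     ('g::ab_group_add \<Rightarrow> 'l set) \<Rightarrow> bool" where
  "graded_hom_lie_algebra scaleL bracket \<alpha> L \<longleftrightarrow>
     hom_lie_algebra scaleL bracket \<alpha> \<and>
     direct_sum_decomposition scaleL L \<and>
     (\<forall>g h. \<forall>x \<in> L g. \<forall>y \<in> L h. bracket x y \<in> L (g + h)) \<and>
     preserves_grading \<alpha> L"

text \<open>
  As for the plain notion of a graded module, only the action is required to respect the grading.
  No condition is imposed on the twist \<open>\<beta>\<close>, and \<open>preserves_grading \<beta> V\<close> has to be assumed separately
  for derivations to split into homogeneous ones: if \<open>D\<close> is the sum of homogeneous derivations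
  \<open>D\<^sub>g\<close>, then \<open>D\<^sub>g\<close> is forced to be the degree \<open>g\<close> part of \<open>D\<close>, and \<open>D \<circ> \<alpha> = \<beta> \<circ> D\<close> passes to
  these parts only if \<open>\<beta>\<close> respects the grading to that extent. For example, let the Hom-Lie
  algebra be the complex numbers in degree \<open>0\<close> with zero bracket and \<open>\<alpha> = id\<close>; let it act by zero
  on a two-dimensional space with basis \<open>e\<close>, \<open>f\<close> in distinct degrees \<open>0\<close>, \<open>a\<close>, where \<open>\<beta>\<close> swaps
  \<open>e\<close> and \<open>f\<close>. Then \<open>1 \<mapsto> e + f\<close> is a derivation, but its degree \<open>0\<close> part \<open>1 \<mapsto> e\<close> is not.
\<close>

definition graded_hom_lie_module ::
    "(complex \<Rightarrow> 'l::ab_group_add \<Rightarrow> 'l) \<Rightarrow> ('l \<Rightarrow> 'l \<Rightarrow> 'l) \<Rightarrow> ('l \<Rightarrow> 'l) \<Rightarrow>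
     ('g::ab_group_add \<Rightarrow> 'l set) \<Rightarrow>
     (complex \<Rightarrow> 'v::ab_group_add \<Rightarrow> 'v) \<Rightarrow> ('v \<Rightarrow> 'v) \<Rightarrow> ('l \<Rightarrow> 'v \<Rightarrow> 'v) \<Rightarrow>
     ('g \<Rightarrow> 'v set) \<Rightarrow> bool" where
  "graded_hom_lie_module scaleL bracket \<alpha> L scaleV \<beta> \<rho> V \<longleftrightarrow>
     hom_lie_module scaleL bracket \<alpha> scaleV \<beta> \<rho> \<and>
     direct_sum_decomposition scaleV V \<and>
     (\<forall>g h. \<forall>x \<in> L g. \<forall>v \<in> V h. \<rho> x v \<in> V (g + h))"

text \<open>Subalgebras are taken with respect to the bracket alone; closure under \<open>\<alpha>\<close> is not imposed.\<close>

definition subalgebra ::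
    "(complex \<Rightarrow> 'l::ab_group_add \<Rightarrow> 'l) \<Rightarrow> ('l \<Rightarrow> 'l \<Rightarrow> 'l) \<Rightarrow> 'l set \<Rightarrow> bool" where
  "subalgebra scaleL bracket A \<longleftrightarrow>
     module.subspace scaleL A \<and> (\<forall>x \<in> A. \<forall>y \<in> A. bracket x y \<in> A)"

definition finitely_generated_algebra ::
    "(complex \<Rightarrow> 'l::ab_group_add \<Rightarrow> 'l) \<Rightarrow> ('l \<Rightarrow> 'l \<Rightarrow> 'l) \<Rightarrow> bool" where
  "finitely_generated_algebra scaleL bracket \<longleftrightarrow>
     (\<exists>S. finite S \<and> (subalgebra scaleL bracket hull S) = UNIV)"

definition Der ::
    "(complex \<Rightarrow> 'l::ab_group_add \<Rightarrow> 'l) \<Rightarrow> ('l \<Rightarrow> 'l \<Rightarrow> 'l) \<Rightarrow> ('l \<Rightarrow> 'l) \<Rightarrow>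
     (complex \<Rightarrow> 'v::ab_group_add \<Rightarrow> 'v) \<Rightarrow> ('v \<Rightarrow> 'v) \<Rightarrow> ('l \<Rightarrow> 'v \<Rightarrow> 'v) \<Rightarrow> ('l \<Rightarrow> 'v) set" where
  "Der scaleL bracket \<alpha> scaleV \<beta> \<rho> =
     {D. Vector_Spaces.linear scaleL scaleV D \<and> D \<circ> \<alpha> = \<beta> \<circ> D \<and>
         (\<forall>x y. D (bracket x y) = \<rho> x (D y) - \<rho> y (D x))}"

definition has_degree ::
    "('g::ab_group_add \<Rightarrow> 'l set) \<Rightarrow> ('g \<Rightarrow> 'v::ab_group_add set) \<Rightarrow> ('l \<Rightarrow> 'v) \<Rightarrow> 'g \<Rightarrow> bool" where
  "has_degree L V D g \<longleftrightarrow> D \<noteq> (\<lambda>_. 0) \<and> (\<forall>h. D ` L h \<subseteq> V (g + h))"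

definition Der_degree ::
    "(complex \<Rightarrow> 'l::ab_group_add \<Rightarrow> 'l) \<Rightarrow> ('l \<Rightarrow> 'l \<Rightarrow> 'l) \<Rightarrow> ('l \<Rightarrow> 'l) \<Rightarrow>
     ('g::ab_group_add \<Rightarrow> 'l set) \<Rightarrow>
     (complex \<Rightarrow> 'v::ab_group_add \<Rightarrow> 'v) \<Rightarrow> ('v \<Rightarrow> 'v) \<Rightarrow> ('l \<Rightarrow> 'v \<Rightarrow> 'v) \<Rightarrow>
     ('g \<Rightarrow> 'v set) \<Rightarrow> 'g \<Rightarrow> ('l \<Rightarrow> 'v) set" where
  "Der_degree scaleL bracket \<alpha> L scaleV \<beta> \<rho> V g =
     {D \<in> Der scaleL bracket \<alpha> scaleV \<beta> \<rho>. has_degree L V D g} \<union> {\<lambda>_. 0}"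

end

theory Submission
  imports Defs
begin

text \<open>
  The degree \<open>g\<close> part of \<open>D\<close> sends a homogeneous \<open>x\<close> of degree \<open>h\<close> to the degree \<open>g + h\<close>
  component of \<open>D x\<close>, and is extended additively. Such parts exist for every additive map \<open>f\<close>
  between graded groups, and they add up to \<open>f\<close> locally finitely: \<open>u\<close> has finitely many
  components, and \<open>f\<close> of each of them has finitely many components
  (\<open>finite_degree_parts\<close>, \<open>sum_degree_parts\<close>).

  It remains that every degree part of a derivation is a derivation. All identities to be checked
  are additive in each argument, so homogeneous arguments suffice
  (\<open>additive_eq_if_eq_on_homogeneous\<close>). There, \<open>D\<^sub>g\<close> is \<open>D\<close> followed by taking one component, and
  taking components commutes with homogeneous maps up to a shift of degrees
  (\<open>component_homogeneous_map\<close>). The maps in question are the action of a homogeneous element, the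
  scalar multiplications and the twist \<open>\<beta>\<close>, the last because it is assumed to preserve the grading.
\<close>

section \<open>Homogeneous components\<close>

definition component :: "('g \<Rightarrow> 'a::ab_group_add set) \<Rightarrow> 'a \<Rightarrow> 'g \<Rightarrow> 'a" where
  "component X v = (THE c. (\<forall>g. c g \<in> X g) \<and> finite {g. c g \<noteq> 0} \<and> v = (\<Sum>g | c g \<noteq> 0. c g))"

text \<open>
  Components are studied for additive groups rather than vector spaces: a scalar multiplication is
  then just another additive map that preserves degrees, so compatibility with scalars becomes a
  case of the general fact on homogeneous maps.
\<close>

locale graded_group =
  fixes X :: "'g::ab_group_add \<Rightarrow> 'a::ab_group_add set"
  assumes zero_mem: "0 \<in> X g"
    and add_mem: "x \<in> X g \<Longrightarrow> y \<in> X g \<Longrightarrow> x + y \<in> X g"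
    and unique_decomposition:
      "\<exists>!c. (\<forall>g. c g \<in> X g) \<and> finite {g. c g \<noteq> 0} \<and> v = (\<Sum>g | c g \<noteq> 0. c g)"
begin

lemma component_mem: "component X v g \<in> X g"
  and finite_support: "finite {g. component X v g \<noteq> 0}"
  and sum_components: "(\<Sum>g | component X v g \<noteq> 0. component X v g) = v"
  using theI'[OF unique_decomposition[of v]] unfolding component_def by auto

lemma component_eqI:
  assumes "\<And>g. c g \<in> X g" "finite S" "\<And>g. g \<notin> S \<Longrightarrow> c g = 0" "v = sum c S"
  shows "component X v = c"
proof -
  have sub: "{g. c g \<noteq> 0} \<subseteq> S" using assms(3) by auto
  have "v = (\<Sum>g | c g \<noteq> 0. c g)"
    unfolding assms(4) by (rule sum.mono_neutral_right[OF assms(2) sub]) auto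
  moreover have "finite {g. c g \<noteq> 0}" using sub assms(2) by (rule finite_subset)
  ultimately show ?thesis
    unfolding component_def by (intro the1_equality[OF unique_decomposition]) (use assms(1) in auto)
qed

lemma sum_components_superset:
  assumes "finite S" "{g. component X v g \<noteq> 0} \<subseteq> S"
  shows "sum (component X v) S = v"
proof -
  have "sum (component X v) S = (\<Sum>g | component X v g \<noteq> 0. component X v g)"
    by (rule sum.mono_neutral_right[OF assms]) auto
  then show ?thesis by (simp add: sum_components)
qed

lemma component_zero: "component X 0 = (\<lambda>_. 0)"
  by (rule component_eqI[of _ "{}"]) (auto simp: zero_mem)

lemma component_add: "component X (v + w) g = component X v g + component X w g"
proof -
  let ?S = "{g. component X v g \<noteq> 0} \<union> {g. component X w g \<noteq> 0}"
  have fin: "finite ?S" by (simp add: finite_support)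
  have "component X (v + w) = (\<lambda>g. component X v g + component X w g)"
    by (rule component_eqI[of _ ?S])
      (auto simp: component_mem add_mem finite_support sum.distrib
        sum_components_superset[OF fin])
  then show ?thesis by simp
qed

lemma additive_component: "additive (\<lambda>v. component X v g)"
  by standard (rule component_add)

lemma component_homogeneous:
  assumes "x \<in> X h"
  shows "component X x = (\<lambda>g. if g = h then x else 0)"
  by (rule component_eqI[of _ "{h}"]) (auto simp: assms zero_mem)

lemma additive_sum_components:
  assumes "additive f"
  shows "f v = (\<Sum>g | component X v g \<noteq> 0. f (component X v g))"
  by (subst sum_components[symmetric]) (rule additive.sum[OF assms])

lemma additive_eq_if_eq_on_homogeneous:
  assumes "additive f" "additive f'" "\<And>g x. x \<in> X g \<Longrightarrow> f x = f' x"
  shows "f v = f' v"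
  using additive_sum_components[OF assms(1), of v] additive_sum_components[OF assms(2), of v]
    assms(3)[OF component_mem] by simp

end

text \<open>
  Applying \<open>f\<close> to the components of \<open>v\<close> gives a decomposition of \<open>f v\<close> into homogeneous
  elements, with all degrees shifted by \<open>s\<close>; decompositions are unique.
\<close>

lemma component_homogeneous_map:
  assumes X: "graded_group X" and Y: "graded_group Y"
    and f: "additive f" and deg: "\<And>g x. x \<in> X g \<Longrightarrow> f x \<in> Y (s + g)"
  shows "component Y (f v) (s + g) = f (component X v g)"
proof -
  interpret X: graded_group X by (rule X)
  interpret Y: graded_group Y by (rule Y)
  let ?S = "{g. component X v g \<noteq> 0}"
  have "component Y (f v) = (\<lambda>k. f (component X v (k - s)))"
  proof (rule Y.component_eqI[of _ "(+) s ` ?S"])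
    show "f (component X v (k - s)) \<in> Y k" for k
      using deg[OF X.component_mem, of v "k - s"] by simp
    show "finite ((+) s ` ?S)" using X.finite_support by auto
    show "f (component X v (k - s)) = 0" if "k \<notin> (+) s ` ?S" for k
    proof -
      have "k = s + (k - s)" by simp
      with that have "component X v (k - s) = 0" by blast
      then show ?thesis by (simp add: additive.zero[OF f])
    qed
    show "f v = (\<Sum>k\<in>(+) s ` ?S. f (component X v (k - s)))"
      by (simp add: sum.reindex X.additive_sum_components[OF f, of v])
  qed
  then show ?thesis by simp
qed

section \<open>Degree parts of an additive map\<close>

definition degree_part ::
    "('g::ab_group_add \<Rightarrow> 'a::ab_group_add set) \<Rightarrow> ('g \<Rightarrow> 'b::ab_group_add set) \<Rightarrow> ('a \<Rightarrow> 'b) \<Rightarrow>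
     'g \<Rightarrow> 'a \<Rightarrow> 'b" where
  "degree_part X Y f g u =
     (\<Sum>h | component X u h \<noteq> 0. component Y (f (component X u h)) (g + h))"

locale additive_map_graded_groups = X: graded_group X + Y: graded_group Y + additive f
  for X :: "'g::ab_group_add \<Rightarrow> 'a::ab_group_add set"
    and Y :: "'g \<Rightarrow> 'b::ab_group_add set"
    and f :: "'a \<Rightarrow> 'b"
begin

text \<open>
  Summing over a common finite set of degrees makes the sums for different arguments comparable,
  which the support of each single argument does not.
\<close>

lemma degree_part_superset:
  assumes "finite S" "{h. component X u h \<noteq> 0} \<subseteq> S"
  shows "degree_part X Y f g u = (\<Sum>h\<in>S. component Y (f (component X u h)) (g + h))"
  unfolding degree_part_def
  by (rule sum.mono_neutral_left[OF assms]) (auto simp: zero Y.component_zero)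

lemma additive_degree_part: "additive (degree_part X Y f g)"
proof
  fix u w
  let ?S = "{h. component X u h \<noteq> 0} \<union> {h. component X w h \<noteq> 0}"
  have "finite ?S" by (simp add: X.finite_support)
  moreover have "{h. component X (u + w) h \<noteq> 0} \<subseteq> ?S" by (auto simp: X.component_add)
  ultimately show "degree_part X Y f g (u + w) = degree_part X Y f g u + degree_part X Y f g w"
    by (simp add: degree_part_superset[of ?S] X.component_add add Y.component_add sum.distrib)
qed

lemma degree_part_homogeneous:
  assumes "x \<in> X h"
  shows "degree_part X Y f g x = component Y (f x) (g + h)"
  by (subst degree_part_superset[of "{h}"]) (auto simp: X.component_homogeneous[OF assms])

text \<open>
  Used twice: with scalar multiplications for linearity, and with the twists \<open>\<alpha>\<close>, \<open>\<beta>\<close> for the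
  compatibility condition on derivations.
\<close>

lemma degree_part_commute:
  assumes a: "additive a" "\<And>h x. x \<in> X h \<Longrightarrow> a x \<in> X h"
    and b: "additive b" "\<And>h y. y \<in> Y h \<Longrightarrow> b y \<in> Y h"
    and comm: "\<And>u. f (a u) = b (f u)"
  shows "degree_part X Y f g (a u) = b (degree_part X Y f g u)"
proof (rule X.additive_eq_if_eq_on_homogeneous)
  interpret P: additive "degree_part X Y f g" by (rule additive_degree_part)
  show "additive (\<lambda>u. degree_part X Y f g (a u))"
    by standard (simp add: P.add additive.add[OF a(1)])
  show "additive (\<lambda>u. b (degree_part X Y f g u))"
    by standard (simp add: P.add additive.add[OF b(1)])
  show "degree_part X Y f g (a x) = b (degree_part X Y f g x)" if x: "x \<in> X h" for h x
    using component_homogeneous_map[OF Y.graded_group_axioms Y.graded_group_axioms b(1),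
        where s = 0 and v = "f x" and g = "g + h"] b(2)
    by (simp add: degree_part_homogeneous[OF x] degree_part_homogeneous[OF a(2)[OF x]] comm)
qed

text \<open>
  The degree \<open>g\<close> contributes only if \<open>g + h\<close> is the degree of a component of \<open>f u\<^sub>h\<close> for one of
  the finitely many components \<open>u\<^sub>h\<close> of \<open>u\<close>.
\<close>

lemma finite_degree_parts: "finite {g. degree_part X Y f g u \<noteq> 0}"
  and sum_degree_parts: "(\<Sum>g | degree_part X Y f g u \<noteq> 0. degree_part X Y f g u) = f u"
proof -
  define S where "S = {h. component X u h \<noteq> 0}"
  define R where "R h = {k. component Y (f (component X u h)) k \<noteq> 0}" for h
  define T where "T = (\<Union>h\<in>S. (\<lambda>k. k - h) ` R h)"
  have finS: "finite S" unfolding S_def by (rule X.finite_support)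
  have finR: "finite (R h)" for h unfolding R_def by (rule Y.finite_support)
  have finT: "finite T" unfolding T_def using finS finR by auto
  have memT: "g \<in> T" if "h \<in> S" "component Y (f (component X u h)) (g + h) \<noteq> 0" for g h
    using that unfolding T_def R_def by (intro UN_I[of h] image_eqI[of _ _ "g + h"]) auto
  have sub: "{g. degree_part X Y f g u \<noteq> 0} \<subseteq> T"
  proof
    fix g assume "g \<in> {g. degree_part X Y f g u \<noteq> 0}"
    then have "(\<Sum>h\<in>S. component Y (f (component X u h)) (g + h)) \<noteq> 0"
      by (simp add: degree_part_def S_def)
    then obtain h where "h \<in> S" "component Y (f (component X u h)) (g + h) \<noteq> 0"
      by (rule sum.not_neutral_contains_not_neutral)
    then show "g \<in> T" by (rule memT)
  qed
  show "finite {g. degree_part X Y f g u \<noteq> 0}" using sub finT by (rule finite_subset)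
  have inner: "(\<Sum>g\<in>T. component Y (f (component X u h)) (g + h)) = f (component X u h)"
    if h: "h \<in> S" for h
  proof -
    have "R h \<subseteq> (\<lambda>g. g + h) ` T"
    proof
      fix k assume "k \<in> R h"
      then have "k - h \<in> T" using h by (intro memT) (auto simp: R_def)
      then show "k \<in> (\<lambda>g. g + h) ` T" by (rule image_eqI[rotated]) simp
    qed
    then have "sum (component Y (f (component X u h))) ((\<lambda>g. g + h) ` T) = f (component X u h)"
      using finT by (intro Y.sum_components_superset) (auto simp: R_def)
    then show ?thesis by (simp add: sum.reindex)
  qed
  have "(\<Sum>g | degree_part X Y f g u \<noteq> 0. degree_part X Y f g u)
      = (\<Sum>g\<in>T. degree_part X Y f g u)"
    by (rule sum.mono_neutral_left[OF finT sub]) auto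
  also have "\<dots> = (\<Sum>h\<in>S. \<Sum>g\<in>T. component Y (f (component X u h)) (g + h))"
    unfolding degree_part_def S_def[symmetric] by (rule sum.swap)
  also have "\<dots> = (\<Sum>h\<in>S. f (component X u h))" using inner by simp
  also have "\<dots> = f u" unfolding S_def
    by (rule X.additive_sum_components[symmetric]) unfold_locales
  finally show "(\<Sum>g | degree_part X Y f g u \<noteq> 0. degree_part X Y f g u) = f u" .
qed

end

section \<open>Degree parts of derivations\<close>

lemma graded_group_direct_sum_decomposition:
  assumes "vector_space scale" "direct_sum_decomposition scale X"
  shows "graded_group X"
proof -
  interpret vector_space scale by (rule assms(1))
  show ?thesis
    using assms(2) unfolding direct_sum_decomposition_def
    by (intro graded_group.intro) (auto intro: subspace_0 subspace_add)
qed

lemma additive_linear: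
  assumes "Vector_Spaces.linear s1 s2 f"
  shows "additive f"
proof -
  interpret Vector_Spaces.linear s1 s2 f by (rule assms)
  show ?thesis by standard (rule add)
qed

lemma linear_degree_part:
  assumes f: "Vector_Spaces.linear scaleX scaleY f"
    and X: "direct_sum_decomposition scaleX X" and Y: "direct_sum_decomposition scaleY Y"
  shows "Vector_Spaces.linear scaleX scaleY (degree_part X Y f g)"
proof -
  interpret f: Vector_Spaces.linear scaleX scaleY f by (rule f)
  interpret additive_map_graded_groups X Y f
    by (intro additive_map_graded_groups.intro additive_linear[OF f]
        graded_group_direct_sum_decomposition[OF f.vs1.vector_space_axioms X]
        graded_group_direct_sum_decomposition[OF f.vs2.vector_space_axioms Y])
  have "degree_part X Y f g (scaleX r u) = scaleY r (degree_part X Y f g u)" for r u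
  proof (rule degree_part_commute)
    show "additive (scaleX r)" by standard (rule f.vs1.scale_right_distrib)
    show "additive (scaleY r)" by standard (rule f.vs2.scale_right_distrib)
    show "scaleX r x \<in> X h" if "x \<in> X h" for h x
      using X that unfolding direct_sum_decomposition_def by (blast intro: f.vs1.subspace_scale)
    show "scaleY r y \<in> Y h" if "y \<in> Y h" for h y
      using Y that unfolding direct_sum_decomposition_def by (blast intro: f.vs2.subspace_scale)
    show "f (scaleX r u) = scaleY r (f u)" for u by (rule f.scale)
  qed
  then show ?thesis
    by unfold_locales (simp_all add: additive.add[OF additive_degree_part])
qed

text \<open>
  For \<open>x\<close> and \<open>y\<close> homogeneous of degrees \<open>h\<close> and \<open>k\<close>, the Leibniz rule of \<open>degree_part L V D g\<close>
  is the degree \<open>g + h + k\<close> component of the Leibniz rule of \<open>D\<close>.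
\<close>

lemma degree_part_in_Der_degree:
  fixes L :: "'g::ab_group_add \<Rightarrow> 'l::ab_group_add set" and V :: "'g \<Rightarrow> 'v::ab_group_add set"
  assumes alg: "graded_hom_lie_algebra scaleL bracket \<alpha> L"
    and mod: "graded_hom_lie_module scaleL bracket \<alpha> L scaleV \<beta> \<rho> V"
    and beta: "preserves_grading \<beta> V"
    and D: "D \<in> Der scaleL bracket \<alpha> scaleV \<beta> \<rho>"
  shows "degree_part L V D g \<in> Der_degree scaleL bracket \<alpha> L scaleV \<beta> \<rho> V g"
proof -
  interpret hom_lie_module scaleL bracket \<alpha> scaleV \<beta> \<rho>
    using mod by (simp add: graded_hom_lie_module_def)
  have L: "direct_sum_decomposition scaleL L" and V: "direct_sum_decomposition scaleV V"
    using alg mod by (simp_all add: graded_hom_lie_algebra_def graded_hom_lie_module_def)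
  have D_lin: "Vector_Spaces.linear scaleL scaleV D"
    and D_twist: "D (\<alpha> u) = \<beta> (D u)"
    and D_bracket: "D (bracket x y) = \<rho> x (D y) - \<rho> y (D x)" for u x y
    using D by (auto simp: Der_def dest: fun_cong)
  interpret additive_map_graded_groups L V D
    by (intro additive_map_graded_groups.intro additive_linear[OF D_lin]
        graded_group_direct_sum_decomposition[OF vector_space_axioms L]
        graded_group_direct_sum_decomposition[OF V.vector_space_axioms V])
  let ?P = "degree_part L V D g"
  interpret P: additive ?P by (rule additive_degree_part)
  note bracket_add = additive.add[OF additive_linear[OF bracket_linear_left]]
    additive.add[OF additive_linear[OF bracket_linear_right]]
  note action_add = additive.add[OF additive_linear[OF action_linear]]
    additive.add[OF additive_linear[OF action_endo]]
  have bracket_mem: "bracket x y \<in> L (h + k)" if "x \<in> L h" "y \<in> L k" for x y h k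
    using alg that by (simp add: graded_hom_lie_algebra_def)
  have component_action: "component V (\<rho> x v) (h + k) = \<rho> x (component V v k)"
    if "x \<in> L h" for x h v k
    using mod that
    by (intro component_homogeneous_map Y.graded_group_axioms additive_linear[OF action_endo])
      (auto simp: graded_hom_lie_module_def)
  have twist: "?P (\<alpha> u) = \<beta> (?P u)" for u
    using alg beta D_twist
    by (intro degree_part_commute additive_linear[OF twist_linear]
        additive_linear[OF module_twist_linear])
      (auto simp: graded_hom_lie_algebra_def preserves_grading_def image_subset_iff)
  have leibniz_homogeneous: "?P (bracket x y) = \<rho> x (?P y) - \<rho> y (?P x)"
    if x: "x \<in> L h" and y: "y \<in> L k" for x y h k
  proof -
    have "?P (bracket x y) = component V (\<rho> x (D y) - \<rho> y (D x)) (g + (h + k))"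
      by (simp add: degree_part_homogeneous[OF bracket_mem[OF x y]] D_bracket)
    also have "\<dots> = component V (\<rho> x (D y)) (h + (g + k)) - component V (\<rho> y (D x)) (k + (g + h))"
      by (simp add: additive.diff[OF Y.additive_component] ac_simps)
    finally show ?thesis
      by (simp add: component_action[OF x] component_action[OF y]
          degree_part_homogeneous[OF x] degree_part_homogeneous[OF y])
  qed
  \<comment> \<open>Pass from homogeneous to arbitrary arguments, first in \<open>y\<close>, then in \<open>x\<close>.\<close>
  have additive_leibniz:
    "additive (\<lambda>x. ?P (bracket x y))" "additive (\<lambda>y. ?P (bracket x y))"
    "additive (\<lambda>x. \<rho> x (?P y) - \<rho> y (?P x))" "additive (\<lambda>y. \<rho> x (?P y) - \<rho> y (?P x))" for x y
    by (simp_all add: additive_def bracket_add action_add P.add)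
  have leibniz_left: "?P (bracket x y) = \<rho> x (?P y) - \<rho> y (?P x)" if "x \<in> L h" for x y h
    using additive_leibniz(2,4) leibniz_homogeneous[OF that]
    by (rule X.additive_eq_if_eq_on_homogeneous)
  have leibniz: "?P (bracket x y) = \<rho> x (?P y) - \<rho> y (?P x)" for x y
    using additive_leibniz(1,3) leibniz_left by (rule X.additive_eq_if_eq_on_homogeneous)
  have "?P \<in> Der scaleL bracket \<alpha> scaleV \<beta> \<rho>"
    using linear_degree_part[OF D_lin L V] twist leibniz by (auto simp: Der_def)
  moreover have "?P ` L h \<subseteq> V (g + h)" for h
    by (auto simp: degree_part_homogeneous Y.component_mem)
  ultimately show ?thesis by (auto simp: Der_degree_def has_degree_def)
qed

theorem proposition3p5:
  fixes scaleL :: "complex \<Rightarrow> 'l::ab_group_add \<Rightarrow> 'l"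
    and bracket :: "'l \<Rightarrow> 'l \<Rightarrow> 'l"
    and \<alpha> :: "'l \<Rightarrow> 'l"
    and L :: "'g::ab_group_add \<Rightarrow> 'l set"
    and scaleV :: "complex \<Rightarrow> 'v::ab_group_add \<Rightarrow> 'v"
    and \<beta> :: "'v \<Rightarrow> 'v"
    and \<rho> :: "'l \<Rightarrow> 'v \<Rightarrow> 'v"
    and V :: "'g \<Rightarrow> 'v set"
    and D :: "'l \<Rightarrow> 'v"
  assumes "graded_hom_lie_algebra scaleL bracket \<alpha> L"
    and "finitely_generated_algebra scaleL bracket"
    and "graded_hom_lie_module scaleL bracket \<alpha> L scaleV \<beta> \<rho> V"
    and "preserves_grading \<beta> V"
    and "D \<in> Der scaleL bracket \<alpha> scaleV \<beta> \<rho>"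
  shows "\<exists>D' :: 'g \<Rightarrow> 'l \<Rightarrow> 'v.
           (\<forall>g. D' g \<in> Der_degree scaleL bracket \<alpha> L scaleV \<beta> \<rho> V g) \<and>
           (\<forall>u. finite {g. D' g u \<noteq> 0} \<and> D u = (\<Sum>g | D' g u \<noteq> 0. D' g u))"
proof (intro exI conjI allI)
  interpret hom_lie_module scaleL bracket \<alpha> scaleV \<beta> \<rho>
    using assms(3) by (simp add: graded_hom_lie_module_def)
  interpret additive_map_graded_groups L V D
    using assms
    by (intro additive_map_graded_groups.intro
        graded_group_direct_sum_decomposition[OF vector_space_axioms]
        graded_group_direct_sum_decomposition[OF V.vector_space_axioms]
        additive_linear[of scaleL scaleV])
      (simp_all add: graded_hom_lie_algebra_def graded_hom_lie_module_def Der_def)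
  show "degree_part L V D g \<in> Der_degree scaleL bracket \<alpha> L scaleV \<beta> \<rho> V g" for g
    using assms(1,3,4,5) by (rule degree_part_in_Der_degree)
  show "finite {g. degree_part L V D g u \<noteq> 0}" for u by (rule finite_degree_parts)
  show "D u = (\<Sum>g | degree_part L V D g u \<noteq> 0. degree_part L V D g u)" for u
    by (rule sum_degree_parts[symmetric])
qed

end
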